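(* Let $A$ be a bounded set in a Banach lattice $E$. If there exists a d-convergent sequence $(x_n)_{n=1}^\infty$ in $A$ such that $\chi(A)=\chi\bigl(\{x_n\}_{n=1}^\infty\bigr)$, then $\chi(A)=\rho(A)$.
   Context: Banach lattices are complex unless specified otherwise. $E_+$ is the positive cone, $B_E$ the unit ball, and for $u\in E_+$, $[-u,u]=\{x\in E:|x|\le u\}$. A sequence (or net) $(x_\alpha)$ in $E$ d-converges to $x\in E$ if $\||x_\alpha-x|\wedge y\|\to0$ for every $y\in E_+$; it is d-convergent if it d-converges to some $x\in E$. For a bounded set $A\subseteq E$: $\chi(A)=\inf\{\delta>0 : A \text{ can be covered by finitely many balls of radius }\delta\}$ and $\rho(A)=\inf\{\delta>0 : A\subseteq[-u,u]+\delta B_E\text{ for some }u\in E_+\}$. *)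

theory Defs
  imports "HOL-Analysis.Analysis" "HOL-Library.Lattice_Algebras"
begin

section \<open>Real Banach lattices\<close>

class real_banach_lattice = banach + ordered_real_vector + lattice_ab_group_add_abs +
  assumes norm_mono_abs: "\<bar>x\<bar> \<le> \<bar>y\<bar> \<Longrightarrow> norm x \<le> norm y"

instance real :: real_banach_lattice
  by standard simp

lemma norm_abs [simp]: "norm \<bar>x\<bar> = norm x" for x :: "'a::real_banach_lattice"
  by (intro order.antisym norm_mono_abs) simp_all

lemma norm_mono_pos:
  fixes x y :: "'a::real_banach_lattice"
  assumes "0 \<le> x" "x \<le> y"
  shows "norm x \<le> norm y"
  using assms by (intro norm_mono_abs) (simp add: order_trans[OF assms])

lemma nonneg_limit:
  fixes x :: "'a::real_banach_lattice"
  assumes "X \<longlonglongrightarrow> x" "\<And>n. 0 \<le> X n"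
  shows "0 \<le> x"
proof -
  have bound: "norm (sup (- x) 0) \<le> norm (X n - x)" for n
  proof -
    have "- x \<le> X n - x" using assms(2)[of n] by simp
    also have "\<dots> \<le> \<bar>X n - x\<bar>" by (rule abs_ge_self)
    finally have "sup (- x) 0 \<le> \<bar>X n - x\<bar>" by simp
    then have "norm (sup (- x) 0) \<le> norm \<bar>X n - x\<bar>"
      by (intro norm_mono_pos) simp_all
    then show ?thesis by simp
  qed
  have "(\<lambda>n. norm (X n - x)) \<longlonglongrightarrow> 0"
    using assms(1) by (simp add: LIM_zero_iff tendsto_norm_zero)
  then have "norm (sup (- x) 0) \<le> 0"
    using bound by (intro LIMSEQ_le_const) auto
  then have "sup (- x) 0 = 0" by simp
  then have "- x \<le> 0" by (metis sup.cobounded1)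
  then show ?thesis by simp
qed

lemma le_limit:
  fixes x y :: "'a::real_banach_lattice"
  assumes "X \<longlonglongrightarrow> x" "Y \<longlonglongrightarrow> y" "\<And>n. X n \<le> Y n"
  shows "x \<le> y"
  using nonneg_limit[OF tendsto_diff[OF assms(2,1)]] assms(3) by simp


section \<open>Complex Banach lattices\<close>

text \<open>
  A complex Banach lattice is the complexification \<open>E + iE\<close> of a real Banach lattice \<open>E\<close>,
  with modulus \<open>|x + iy| = sup {cos \<theta> x + sin \<theta> y | \<theta> real}\<close>, taken in \<open>E\<close>, and norm
  \<open>\<parallel>z\<parallel> = \<parallel> |z| \<parallel>\<close>. Its positive cone is that of \<open>E\<close>, which is represented below by the elements
  \<open>0 \<le> u\<close> of the real type \<open>'a\<close>.
\<close>

datatype 'a complexification = Cplx (re_part: 'a) (im_part: 'a)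

lemma complexification_eqI:
  "re_part z = re_part w \<Longrightarrow> im_part z = im_part w \<Longrightarrow> z = w"
  by (cases z; cases w) simp

instantiation complexification :: (ab_group_add) ab_group_add
begin

definition "0 = Cplx 0 0"
definition "z + w = Cplx (re_part z + re_part w) (im_part z + im_part w)"
definition "- z = Cplx (- re_part z) (- im_part z)"
definition "z - w = Cplx (re_part z - re_part w) (im_part z - im_part w)"

instance
  by standard
    (simp_all add: zero_complexification_def plus_complexification_def
      uminus_complexification_def minus_complexification_def add.assoc add.commute)

end

instantiation complexification :: (real_vector) real_vector
begin

definition "a *\<^sub>R z = Cplx (a *\<^sub>R re_part z) (a *\<^sub>R im_part z)"

instance
  by standard
    (simp_all add: plus_complexification_def scaleR_complexification_def
      scaleR_add_left scaleR_add_right)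

end

definition scaleC :: "complex \<Rightarrow> 'a::real_vector complexification \<Rightarrow> 'a complexification" where
  "scaleC c z = Cplx (Re c *\<^sub>R re_part z - Im c *\<^sub>R im_part z)
                     (Re c *\<^sub>R im_part z + Im c *\<^sub>R re_part z)"

lemma parts_simps [simp]:
  "re_part 0 = 0" "im_part 0 = 0"
  "re_part (z + w) = re_part z + re_part w" "im_part (z + w) = im_part z + im_part w"
  "re_part (- z) = - re_part z" "im_part (- z) = - im_part z"
  "re_part (z - w) = re_part z - re_part w" "im_part (z - w) = im_part z - im_part w"
  "re_part (a *\<^sub>R v) = a *\<^sub>R re_part v" "im_part (a *\<^sub>R v) = a *\<^sub>R im_part v"
  "re_part (scaleC c v) = Re c *\<^sub>R re_part v - Im c *\<^sub>R im_part v"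
  "im_part (scaleC c v) = Re c *\<^sub>R im_part v + Im c *\<^sub>R re_part v"
  by (simp_all add: zero_complexification_def plus_complexification_def
      uminus_complexification_def minus_complexification_def scaleR_complexification_def
      scaleC_def)

lemma scaleC_of_real [simp]: "scaleC (of_real a) z = a *\<^sub>R z"
  by (rule complexification_eqI) simp_all

definition rot :: "'a::real_vector complexification \<Rightarrow> real \<Rightarrow> 'a" where
  "rot z \<theta> = cos \<theta> *\<^sub>R re_part z + sin \<theta> *\<^sub>R im_part z"

definition modulus :: "'a::real_banach_lattice complexification \<Rightarrow> 'a" where
  "modulus z = (THE s. (\<forall>\<theta>. rot z \<theta> \<le> s) \<and> (\<forall>t. (\<forall>\<theta>. rot z \<theta> \<le> t) \<longrightarrow> s \<le> t))"


subsection \<open>Existence of the modulus\<close>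

lemma abs_scaleR:
  fixes x :: "'a::real_banach_lattice"
  shows "\<bar>a *\<^sub>R x\<bar> \<le> \<bar>a\<bar> *\<^sub>R \<bar>x\<bar>"
proof -
  have *: "b *\<^sub>R y \<le> \<bar>b\<bar> *\<^sub>R \<bar>y\<bar>" for b :: real and y :: 'a
  proof (cases "0 \<le> b")
    case True
    then show ?thesis by (simp add: scaleR_left_mono abs_ge_self)
  next
    case False
    then have "(- b) *\<^sub>R (- y) \<le> (- b) *\<^sub>R \<bar>y\<bar>" by (intro scaleR_left_mono abs_ge_minus_self) auto
    with False show ?thesis by simp
  qed
  show ?thesis using *[of a x] *[of "- a" x] by (intro abs_leI) simp_all
qed

lemma cos_Lipschitz: "\<bar>cos a - cos b\<bar> \<le> \<bar>a - b :: real\<bar>"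
proof -
  have "\<bar>cos a - cos b\<bar> = 2 * (\<bar>sin ((a + b) / 2)\<bar> * \<bar>sin ((b - a) / 2)\<bar>)"
    by (simp add: cos_diff_cos abs_mult)
  also have "\<dots> \<le> 2 * (1 * \<bar>(b - a) / 2\<bar>)"
    by (intro mult_left_mono mult_mono abs_sin_x_le_abs_x abs_sin_le_one) auto
  finally show ?thesis by simp
qed

lemma sin_Lipschitz: "\<bar>sin a - sin b\<bar> \<le> \<bar>a - b :: real\<bar>"
  using cos_Lipschitz[of "pi / 2 - a" "pi / 2 - b"] by (simp add: cos_diff)

lemma rot_Lipschitz:
  fixes z :: "'a::real_banach_lattice complexification"
  shows "rot z a \<le> rot z b + \<bar>a - b\<bar> *\<^sub>R (\<bar>re_part z\<bar> + \<bar>im_part z\<bar>)"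
proof -
  have "rot z a - rot z b = (cos a - cos b) *\<^sub>R re_part z + (sin a - sin b) *\<^sub>R im_part z"
    by (simp add: rot_def algebra_simps)
  also have "\<dots> \<le> \<bar>cos a - cos b\<bar> *\<^sub>R \<bar>re_part z\<bar> + \<bar>sin a - sin b\<bar> *\<^sub>R \<bar>im_part z\<bar>"
    by (intro add_mono order_trans[OF abs_ge_self abs_scaleR])
  also have "\<dots> \<le> \<bar>a - b\<bar> *\<^sub>R \<bar>re_part z\<bar> + \<bar>a - b\<bar> *\<^sub>R \<bar>im_part z\<bar>"
    by (intro add_mono scaleR_right_mono cos_Lipschitz sin_Lipschitz) auto
  finally show ?thesis by (simp add: algebra_simps)
qed

lemma rot_lub_exists:
  fixes z :: "'a::real_banach_lattice complexification"
  shows "\<exists>s. (\<forall>\<theta>. rot z \<theta> \<le> s) \<and> (\<forall>t. (\<forall>\<theta>. rot z \<theta> \<le> t) \<longrightarrow> s \<le> t)"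
proof -
  define e where "e = \<bar>re_part z\<bar> + \<bar>im_part z\<bar>"
  define \<epsilon> where "\<epsilon> m = inverse (real (Suc m))" for m
  define D where "D m = (\<lambda>k. real k * \<epsilon> m) ` {..7 * Suc m}" for m
  define g where "g m = Sup_fin (rot z ` D m)" for m
  have e0: "0 \<le> e" by (simp add: e_def)
  have eps0: "0 < \<epsilon> m" for m by (simp add: \<epsilon>_def)
  have fin: "finite (rot z ` D m)" "rot z ` D m \<noteq> {}" for m by (auto simp: D_def)
  have g_least: "g m \<le> t" if "\<And>\<theta>. rot z \<theta> \<le> t" for m t
    unfolding g_def using fin that by (intro Sup_fin.boundedI) auto
  have near: "rot z \<theta> \<le> g m + \<epsilon> m *\<^sub>R e" for \<theta> m
  proof -
    have "(cos \<theta>)\<^sup>2 + (sin \<theta>)\<^sup>2 = 1" by simp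
    then obtain t where t: "0 \<le> t" "t < 2 * pi" "cos \<theta> = cos t" "sin \<theta> = sin t"
      using sincos_total_2pi by blast
    define k where "k = nat \<lfloor>t * real (Suc m)\<rfloor>"
    have k: "real k \<le> t * real (Suc m)" "t * real (Suc m) \<le> real k + 1"
      using t(1) unfolding k_def by (simp, linarith)
    have "t \<le> 7" using t(2) pi_less_4 pi_approx by simp
    then have "t * real (Suc m) \<le> 7 * real (Suc m)" by (intro mult_right_mono) auto
    with k(1) have "real k \<le> real (7 * Suc m)" by simp
    then have "k \<le> 7 * Suc m" by linarith
    then have inD: "real k * \<epsilon> m \<in> D m" by (auto simp: D_def)
    have te: "t = (t * real (Suc m)) * \<epsilon> m" by (simp add: \<epsilon>_def)
    have "t - real k * \<epsilon> m = (t * real (Suc m) - real k) * \<epsilon> m"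
      using te by (simp only: left_diff_distrib)
    then have close: "\<bar>t - real k * \<epsilon> m\<bar> \<le> \<epsilon> m"
      using k eps0[of m] by (simp add: abs_mult mult_left_le_one_le)
    have "rot z \<theta> = rot z t" using t by (simp add: rot_def)
    also have "\<dots> \<le> rot z (real k * \<epsilon> m) + \<bar>t - real k * \<epsilon> m\<bar> *\<^sub>R e"
      unfolding e_def by (rule rot_Lipschitz)
    also have "\<dots> \<le> g m + \<epsilon> m *\<^sub>R e"
      using inD fin close e0 unfolding g_def
      by (intro add_mono Sup_fin.coboundedI scaleR_right_mono) auto
    finally show ?thesis .
  qed
  have gg: "g n \<le> g m + \<epsilon> m *\<^sub>R e" for n m by (rule g_least) (rule near)
  have eps_lim: "\<epsilon> \<longlonglongrightarrow> 0" unfolding \<epsilon>_def by (rule LIMSEQ_inverse_real_of_nat)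
  have dist_g: "norm (g m - g n) \<le> (\<epsilon> m + \<epsilon> n) * norm e" for m n
  proof -
    have "\<epsilon> m *\<^sub>R e \<le> (\<epsilon> m + \<epsilon> n) *\<^sub>R e" "\<epsilon> n *\<^sub>R e \<le> (\<epsilon> m + \<epsilon> n) *\<^sub>R e"
      using eps0[of m] eps0[of n] e0 by (auto intro!: scaleR_right_mono)
    then have "g m \<le> g n + (\<epsilon> m + \<epsilon> n) *\<^sub>R e" "g n \<le> g m + (\<epsilon> m + \<epsilon> n) *\<^sub>R e"
      using gg[of m n] gg[of n m] by (meson add_left_mono order_trans)+
    then have "\<bar>g m - g n\<bar> \<le> (\<epsilon> m + \<epsilon> n) *\<^sub>R e"
      by (intro abs_leI) (simp_all add: algebra_simps)
    then have "norm \<bar>g m - g n\<bar> \<le> norm ((\<epsilon> m + \<epsilon> n) *\<^sub>R e)"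
      by (intro norm_mono_pos) simp_all
    then show ?thesis using eps0[of m] eps0[of n] by simp
  qed
  have "Cauchy g"
  proof (rule CauchyI)
    fix r :: real assume r: "0 < r"
    have "(\<lambda>n. \<epsilon> n * norm e) \<longlonglongrightarrow> 0"
      using tendsto_mult_right[OF eps_lim, of "norm e"] by simp
    then have "eventually (\<lambda>n. \<epsilon> n * norm e < r / 2) sequentially"
      using r by (intro order_tendstoD) auto
    then obtain N where N: "\<And>n. n \<ge> N \<Longrightarrow> \<epsilon> n * norm e < r / 2"
      by (auto simp: eventually_sequentially)
    show "\<exists>M. \<forall>m\<ge>M. \<forall>n\<ge>M. norm (g m - g n) < r"
    proof (intro exI[of _ N] allI impI)
      fix m n assume "N \<le> m" "N \<le> n"
      then show "norm (g m - g n) < r"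
        using dist_g[of m n] N[of m] N[of n] by (simp add: distrib_right)
    qed
  qed
  then obtain s where s: "g \<longlonglongrightarrow> s"
    using Cauchy_convergent_iff convergent_def by blast
  show ?thesis
  proof (intro exI[of _ s] conjI allI impI)
    fix \<theta>
    have "(\<lambda>m. g m + \<epsilon> m *\<^sub>R e) \<longlonglongrightarrow> s + 0 *\<^sub>R e"
      by (intro tendsto_intros s eps_lim)
    then have "(\<lambda>m. g m + \<epsilon> m *\<^sub>R e) \<longlonglongrightarrow> s" by simp
    then show "rot z \<theta> \<le> s" by (rule le_limit[OF tendsto_const]) (rule near)
  next
    fix t assume "\<forall>\<theta>. rot z \<theta> \<le> t"
    then show "s \<le> t" by (intro le_limit[OF s tendsto_const] g_least) auto
  qed
qed

lemma modulus_lub: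
  fixes z :: "'a::real_banach_lattice complexification"
  shows "(\<forall>\<theta>. rot z \<theta> \<le> modulus z) \<and> (\<forall>t. (\<forall>\<theta>. rot z \<theta> \<le> t) \<longrightarrow> modulus z \<le> t)"
  unfolding modulus_def
  by (rule theI', rule ex_ex1I, rule rot_lub_exists) (meson order.antisym)

lemma rot_le_modulus: "rot z \<theta> \<le> modulus z"
  using modulus_lub by blast

lemma modulus_least: "(\<And>\<theta>. rot z \<theta> \<le> t) \<Longrightarrow> modulus z \<le> t"
  using modulus_lub by blast


subsection \<open>Properties of the modulus\<close>

lemma abs_re_le_modulus: "\<bar>re_part z\<bar> \<le> modulus z"
  using rot_le_modulus[of z 0] rot_le_modulus[of z pi] by (intro abs_leI) (simp_all add: rot_def)

lemma abs_im_le_modulus: "\<bar>im_part z\<bar> \<le> modulus z"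
  using rot_le_modulus[of z "pi / 2"] rot_le_modulus[of z "- (pi / 2)"]
  by (intro abs_leI) (simp_all add: rot_def)

lemma modulus_nonneg [simp]: "0 \<le> modulus z"
  using abs_ge_zero abs_re_le_modulus by (rule order_trans)

lemma modulus_le_sum: "modulus z \<le> \<bar>re_part z\<bar> + \<bar>im_part z\<bar>"
proof (rule modulus_least)
  fix \<theta>
  have "rot z \<theta> \<le> \<bar>cos \<theta>\<bar> *\<^sub>R \<bar>re_part z\<bar> + \<bar>sin \<theta>\<bar> *\<^sub>R \<bar>im_part z\<bar>"
    unfolding rot_def by (intro add_mono order_trans[OF abs_ge_self abs_scaleR])
  also have "\<dots> \<le> 1 *\<^sub>R \<bar>re_part z\<bar> + 1 *\<^sub>R \<bar>im_part z\<bar>"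
    by (intro add_mono scaleR_right_mono) auto
  finally show "rot z \<theta> \<le> \<bar>re_part z\<bar> + \<bar>im_part z\<bar>" by simp
qed

lemma modulus_real [simp]: "modulus (Cplx x 0) = \<bar>x\<bar>"
  using modulus_le_sum[of "Cplx x 0"] abs_re_le_modulus[of "Cplx x 0"] by simp

lemma modulus_eq_0 [simp]: "modulus z = 0 \<longleftrightarrow> z = 0"
proof
  assume "modulus z = 0"
  then show "z = 0"
    using abs_re_le_modulus[of z] abs_im_le_modulus[of z] by (intro complexification_eqI) simp_all
next
  assume "z = 0"
  then show "modulus z = 0" using modulus_real[of 0] by (simp add: zero_complexification_def)
qed

lemma modulus_triangle: "modulus (z + w) \<le> modulus z + modulus w"
proof (rule modulus_least)
  fix \<theta>
  have "rot (z + w) \<theta> = rot z \<theta> + rot w \<theta>" by (simp add: rot_def algebra_simps)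
  also have "\<dots> \<le> modulus z + modulus w" by (intro add_mono rot_le_modulus)
  finally show "rot (z + w) \<theta> \<le> modulus z + modulus w" .
qed

lemma modulus_scaleC: "modulus (scaleC c z) = cmod c *\<^sub>R modulus z"
proof -
  have le: "modulus (scaleC c z) \<le> cmod c *\<^sub>R modulus z"
    for c and z :: "'a complexification"
  proof (rule modulus_least)
    fix \<theta>
    have c: "Re c = cmod c * cos (Arg c)" "Im c = cmod c * sin (Arg c)"
      by (metis Re_rcis rcis_cmod_Arg, metis Im_rcis rcis_cmod_Arg)
    have "rot (scaleC c z) \<theta> = cmod c *\<^sub>R rot z (\<theta> - Arg c)"
      by (simp add: rot_def c cos_diff sin_diff algebra_simps)
    also have "\<dots> \<le> cmod c *\<^sub>R modulus z"
      by (intro scaleR_left_mono rot_le_modulus) simp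
    finally show "rot (scaleC c z) \<theta> \<le> cmod c *\<^sub>R modulus z" .
  qed
  show ?thesis
  proof (cases "c = 0")
    case True
    then have "scaleC c z = 0" by (intro complexification_eqI) simp_all
    with True show ?thesis by simp
  next
    case False
    have "scaleC (inverse c) (scaleC c z) = scaleC (inverse c * c) z"
      by (rule complexification_eqI) (simp_all add: algebra_simps)
    also have "\<dots> = z" using False by (intro complexification_eqI) simp_all
    finally have "modulus z \<le> cmod (inverse c) *\<^sub>R modulus (scaleC c z)"
      using le[of "inverse c" "scaleC c z"] by simp
    then have "cmod c *\<^sub>R modulus z
        \<le> cmod c *\<^sub>R (cmod (inverse c) *\<^sub>R modulus (scaleC c z))"
      by (intro scaleR_left_mono abs_ge_minus_self) auto
    also have "\<dots> = modulus (scaleC c z)" using False by (simp add: norm_inverse)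
    finally show ?thesis using le by (intro order.antisym)
  qed
qed

lemma modulus_scaleR: "modulus (a *\<^sub>R z) = \<bar>a\<bar> *\<^sub>R modulus z"
  using modulus_scaleC[of "of_real a" z] by simp


subsection \<open>The norm\<close>

instantiation complexification :: (real_banach_lattice) real_normed_vector
begin

definition norm_complexification_def: "norm z = norm (modulus z)"

definition sgn_complexification_def:
  "sgn (z :: 'a complexification) = z /\<^sub>R norm z"

definition dist_complexification_def:
  "dist z (w :: 'a complexification) = norm (z - w)"

definition uniformity_complexification_def [code del]:
  "(uniformity :: ('a complexification \<times> 'a complexification) filter)
     = (INF e\<in>{0 <..}. principal {(x, y). dist x y < e})"

definition open_complexification_def [code del]:
  "open (U :: 'a complexification set)
     \<longleftrightarrow> (\<forall>x\<in>U. eventually (\<lambda>(x', y). x' = x \<longrightarrow> y \<in> U) uniformity)"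

instance
proof
  fix r :: real and x y :: "'a complexification"
  show "(norm x = 0) = (x = 0)" by (simp add: norm_complexification_def)
  have "norm (modulus (x + y)) \<le> norm (modulus x + modulus y)"
    by (intro norm_mono_pos modulus_triangle) simp
  also have "\<dots> \<le> norm (modulus x) + norm (modulus y)" by (rule norm_triangle_ineq)
  finally show "norm (x + y) \<le> norm x + norm y" by (simp add: norm_complexification_def)
  show "norm (r *\<^sub>R x) = \<bar>r\<bar> * norm x"
    by (simp add: norm_complexification_def modulus_scaleR)
qed (rule sgn_complexification_def dist_complexification_def
      open_complexification_def uniformity_complexification_def)+

end

lemma norm_real_part_embedding: "norm (Cplx x 0) = norm x"
  by (simp add: norm_complexification_def)

lemma norm_scaleC: "norm (scaleC c z) = cmod c * norm z"
  by (simp add: norm_complexification_def modulus_scaleC)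

lemma norm_parts_le:
  "norm (re_part z) \<le> norm z" "norm (im_part z) \<le> norm z"
  "norm z \<le> norm (re_part z) + norm (im_part z)"
proof -
  show "norm (re_part z) \<le> norm z"
    using norm_mono_pos[OF abs_ge_zero abs_re_le_modulus[of z]]
    by (simp add: norm_complexification_def)
  show "norm (im_part z) \<le> norm z"
    using norm_mono_pos[OF abs_ge_zero abs_im_le_modulus[of z]]
    by (simp add: norm_complexification_def)
  have "norm z \<le> norm (\<bar>re_part z\<bar> + \<bar>im_part z\<bar>)"
    unfolding norm_complexification_def by (intro norm_mono_pos modulus_le_sum) simp
  also have "\<dots> \<le> norm (re_part z) + norm (im_part z)"
    by (rule order_trans[OF norm_triangle_ineq]) simp
  finally show "norm z \<le> norm (re_part z) + norm (im_part z)" .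
qed

lemma bounded_linear_re_part: "bounded_linear re_part"
  by (rule bounded_linear_intro[of _ 1]) (simp_all add: norm_parts_le)

lemma bounded_linear_im_part: "bounded_linear im_part"
  by (rule bounded_linear_intro[of _ 1]) (simp_all add: norm_parts_le)

instance complexification :: (real_banach_lattice) banach
proof
  fix X :: "nat \<Rightarrow> 'a complexification"
  assume X: "Cauchy X"
  obtain a where a: "(\<lambda>n. re_part (X n)) \<longlonglongrightarrow> a"
    using bounded_linear.Cauchy[OF bounded_linear_re_part X] Cauchy_convergent_iff convergent_def
    by blast
  obtain b where b: "(\<lambda>n. im_part (X n)) \<longlonglongrightarrow> b"
    using bounded_linear.Cauchy[OF bounded_linear_im_part X] Cauchy_convergent_iff convergent_def
    by blast
  define G where "G n = norm (re_part (X n) - a) + norm (im_part (X n) - b)" for n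
  have "(\<lambda>n. norm (re_part (X n) - a)) \<longlonglongrightarrow> 0" "(\<lambda>n. norm (im_part (X n) - b)) \<longlonglongrightarrow> 0"
    using a b by (simp_all only: LIM_zero tendsto_norm_zero)
  from tendsto_add[OF this] have G: "G \<longlonglongrightarrow> 0" by (simp add: G_def[abs_def])
  have "norm (X n - Cplx a b) \<le> G n" for n
    using norm_parts_le(3)[of "X n - Cplx a b"] by (simp add: G_def)
  then have "(\<lambda>n. X n - Cplx a b) \<longlonglongrightarrow> 0"
    by (intro Lim_null_comparison[OF _ G] always_eventually allI)
  then have "X \<longlonglongrightarrow> Cplx a b" by (rule LIM_zero_cancel)
  then show "convergent X" by (rule convergentI)
qed


section \<open>d-convergence and the quantities \<open>\<chi>\<close> and \<open>\<rho>\<close>\<close>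

text \<open>Nets are replaced by filters; sequences use the filter \<open>sequentially\<close>.\<close>

definition d_converges ::
  "('i \<Rightarrow> 'a::real_banach_lattice complexification) \<Rightarrow> 'a complexification \<Rightarrow> 'i filter \<Rightarrow> bool" where
  "d_converges X x F \<longleftrightarrow>
     (\<forall>y::'a. 0 \<le> y \<longrightarrow> ((\<lambda>i. norm (inf (modulus (X i - x)) y)) \<longlongrightarrow> 0) F)"

definition d_convergent :: "(nat \<Rightarrow> 'a::real_banach_lattice complexification) \<Rightarrow> bool" where
  "d_convergent X \<longleftrightarrow> (\<exists>x. d_converges X x sequentially)"

definition order_ball :: "'a::real_banach_lattice \<Rightarrow> 'a complexification set" where
  "order_ball u = {x. modulus x \<le> u}"

definition hausdorff_mnc :: "'b::metric_space set \<Rightarrow> real" where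
  "hausdorff_mnc A = Inf {\<delta>. 0 < \<delta> \<and> (\<exists>C. finite C \<and> A \<subseteq> (\<Union>c\<in>C. cball c \<delta>))}"

definition rho :: "'a::real_banach_lattice complexification set \<Rightarrow> real" where
  "rho A = Inf {\<delta>. 0 < \<delta> \<and>
     (\<exists>u::'a. 0 \<le> u \<and> A \<subseteq> {x + \<delta> *\<^sub>R b | x b. x \<in> order_ball u \<and> b \<in> cball 0 1})}"

end

theory Submission
  imports Defs
begin

text \<open>
  A finite \<open>\<delta>\<close>-net \<open>C\<close> of \<open>A\<close> lies in \<open>[-u, u]\<close> with \<open>u = \<Sum>c\<in>C. |c|\<close>, so \<open>\<rho>(A) \<le> \<chi>(A)\<close> always holds.
  Conversely, let \<open>A \<subseteq> [-u, u] + \<delta>B\<close> and let \<open>x\<^sub>n \<in> A\<close> d-converge to \<open>x\<close>. With \<open>w = u + |x|\<close>, each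
  \<open>|x\<^sub>n - x|\<close> is at most \<open>w + \<delta>|b|\<close> for some \<open>b\<close> in the unit ball, hence at most
  \<open>|x\<^sub>n - x| \<and> w + \<delta>|b|\<close>. The first term tends to \<open>0\<close> in norm, so
  \<open>limsup \<parallel>x\<^sub>n - x\<parallel> \<le> \<delta>\<close>, and \<open>x\<close> together with finitely many \<open>x\<^sub>n\<close> is a \<open>(\<delta> + \<epsilon>)\<close>-net of the
  sequence.
\<close>

lemma hausdorff_mnc_le:
  assumes "0 < \<delta>" "finite C" "A \<subseteq> (\<Union>c\<in>C. cball c \<delta>)"
  shows "hausdorff_mnc A \<le> \<delta>"
  unfolding hausdorff_mnc_def using assms
  by (intro cInf_lower bdd_belowI[of _ 0]) auto

lemma bounded_imp_finite_cball_cover: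
  fixes A :: "'b::metric_space set"
  assumes "bounded A"
  shows "\<exists>\<delta>>0. \<exists>C. finite C \<and> A \<subseteq> (\<Union>c\<in>C. cball c \<delta>)"
proof -
  obtain c e where "A \<subseteq> cball c e"
    \<comment> \<open>The radius \<open>e\<close> may be zero, or negative for empty
      \<open>A\<close>; \<open>max e 1\<close> makes it positive.\<close>
    using assms unfolding bounded_def by (auto simp: subset_iff)
  then have "A \<subseteq> (\<Union>c\<in>{c}. cball c (max e 1))" by auto
  then show ?thesis by (intro exI[of _ "max e 1"] conjI exI[of _ "{c}"]) auto
qed

lemma finite_cover_imp_order_ball_cover:
  fixes A :: "'a::real_banach_lattice complexification set"
  assumes "0 < \<delta>" "finite C" and A: "A \<subseteq> (\<Union>c\<in>C. cball c \<delta>)"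
  shows "A \<subseteq> {x + \<delta> *\<^sub>R b | x b. x \<in> order_ball (\<Sum>c\<in>C. modulus c) \<and> b \<in> cball 0 1}"
proof
  fix a assume "a \<in> A"
  with A obtain c where c: "c \<in> C" "dist c a \<le> \<delta>" by auto
  have "modulus c \<le> (\<Sum>c\<in>C. modulus c)"
    using sum_mono2[OF \<open>finite C\<close>, of "{c}" modulus] c by simp
  moreover have "a = c + \<delta> *\<^sub>R ((a - c) /\<^sub>R \<delta>)" using \<open>0 < \<delta>\<close> by simp
  moreover have "(a - c) /\<^sub>R \<delta> \<in> cball 0 1"
    using c \<open>0 < \<delta>\<close>
    by (simp add: dist_norm norm_minus_commute divide_inverse_commute[symmetric] del: scaleR_diff_right)
  ultimately show "a \<in> {x + \<delta> *\<^sub>R b | x b.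
      x \<in> order_ball (\<Sum>c\<in>C. modulus c) \<and> b \<in> cball 0 1}"
    unfolding order_ball_def by blast
qed

lemma rho_le_hausdorff_mnc:
  fixes A :: "'a::real_banach_lattice complexification set"
  assumes "bounded A"
  shows "rho A \<le> hausdorff_mnc A"
  unfolding rho_def hausdorff_mnc_def
\<comment> \<open>Each radius admissible for \<chi> is admissible for \<rho>, and the infimum of the
  larger set is smaller.\<close>
proof (rule cInf_superset_mono)
  show "{\<delta>. 0 < \<delta> \<and> (\<exists>C. finite C \<and> A \<subseteq> (\<Union>c\<in>C. cball c \<delta>))} \<noteq> {}"
    using bounded_imp_finite_cball_cover[OF assms] by auto
next
  show "{\<delta>. 0 < \<delta> \<and> (\<exists>C. finite C \<and> A \<subseteq> (\<Union>c\<in>C. cball c \<delta>))} \<subseteq> {\<delta>. 0 < \<delta> \<and>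
     (\<exists>u. 0 \<le> u \<and> A \<subseteq> {x + \<delta> *\<^sub>R b | x b. x \<in> order_ball u \<and> b \<in> cball 0 1})}"
    using finite_cover_imp_order_ball_cover by (blast intro: sum_nonneg modulus_nonneg)
qed (auto intro: bdd_belowI[of _ 0])

text \<open>Translation distributes over \<open>inf\<close>:
  \<open>inf (modulus z) w + modulus b\<close> is the infimum of
  \<open>modulus z + modulus b\<close> and \<open>w + modulus b\<close>, both of which dominate
  \<open>modulus z\<close>.\<close>

lemma norm_le_norm_inf_add:
  fixes z b :: "'a::real_banach_lattice complexification"
  assumes "modulus z \<le> w + modulus b" "0 \<le> w"
  shows "norm z \<le> norm (inf (modulus z) w) + norm b"
proof -
  have "modulus z \<le> inf (modulus z) w + modulus b"
    using assms by (simp add: add_inf_distrib_right)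
  then have "norm (modulus z) \<le> norm (inf (modulus z) w + modulus b)"
    by (intro norm_mono_pos) simp_all
  also have "\<dots> \<le> norm (inf (modulus z) w) + norm (modulus b)" by (rule norm_triangle_ineq)
  finally show ?thesis by (simp add: norm_complexification_def)
qed

lemma modulus_minus_commute: "modulus (z - w) = modulus (w - z)"
  using modulus_scaleR[of "- 1" "z - w"] by simp

lemma d_converges_norm_diff_le:
  fixes X :: "'i \<Rightarrow> 'a::real_banach_lattice complexification"
  assumes conv: "d_converges X x F" and "0 \<le> u" "0 \<le> \<delta>" "0 < \<epsilon>"
    and X: "range X \<subseteq> {y + \<delta> *\<^sub>R b | y b. y \<in> order_ball u \<and> b \<in> cball 0 1}"
  shows "eventually (\<lambda>i. norm (X i - x) \<le> \<delta> + \<epsilon>) F"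
proof -
  define w where "w = u + modulus x"
  have w: "0 \<le> w" using \<open>0 \<le> u\<close> by (simp add: w_def)
  have le: "norm (X i - x) \<le> norm (inf (modulus (X i - x)) w) + \<delta>" for i
  proof -
    obtain y b where yb: "X i = y + \<delta> *\<^sub>R b" "modulus y \<le> u" "norm b \<le> 1"
      using X by (force simp: order_ball_def)
    \<comment> \<open>Grouped so that \<open>w\<close> absorbs both \<open>y\<close> and the limit
      \<open>x\<close>; writing \<open>0 - x\<close> lets \<open>modulus_minus_commute\<close>
      apply.\<close>
    have "modulus (X i - x) = modulus (y + ((0 - x) + \<delta> *\<^sub>R b))" by (simp add: yb algebra_simps)
    also have "\<dots> \<le> modulus y + (modulus (0 - x) + modulus (\<delta> *\<^sub>R b))"
      by (intro order_trans[OF modulus_triangle] add_left_mono modulus_triangle)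
    also have "\<dots> \<le> w + modulus (\<delta> *\<^sub>R b)"
      using yb(2) modulus_minus_commute[of 0 x] by (simp add: w_def add.assoc)
    finally have "norm (X i - x) \<le> norm (inf (modulus (X i - x)) w) + norm (\<delta> *\<^sub>R b)"
      using w by (rule norm_le_norm_inf_add)
    moreover have "norm (\<delta> *\<^sub>R b) \<le> \<delta>"
      using yb(3) \<open>0 \<le> \<delta>\<close> by (simp add: mult_left_le)
    ultimately show ?thesis by simp
  qed
  have "eventually (\<lambda>i. norm (inf (modulus (X i - x)) w) < \<epsilon>) F"
    using conv w \<open>0 < \<epsilon>\<close> unfolding d_converges_def by (intro order_tendstoD(2)) auto
  then show ?thesis
  proof (rule eventually_mono)
    fix i assume "norm (inf (modulus (X i - x)) w) < \<epsilon>"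
    with le[of i] show "norm (X i - x) \<le> \<delta> + \<epsilon>" by simp
  qed
qed

lemma hausdorff_mnc_range_le:
  fixes X :: "nat \<Rightarrow> 'b::metric_space"
  assumes "0 < r" and ev: "eventually (\<lambda>n. dist (X n) x \<le> r) sequentially"
  shows "hausdorff_mnc (range X) \<le> r"
proof -
  obtain N where N: "\<And>n. n \<ge> N \<Longrightarrow> dist (X n) x \<le> r"
    using ev by (auto simp: eventually_sequentially)
  \<comment> \<open>Each term before \<open>N\<close> is its own centre; the tail uses
    \<open>x\<close>, as centres may lie outside the covered set.\<close>
  have "X n \<in> (\<Union>c\<in>insert x (X ` {..<N}). cball c r)" for n
    using N[of n] \<open>0 < r\<close> by (cases "n < N") (auto simp: dist_commute intro!: bexI[of _ n])
  then have "range X \<subseteq> (\<Union>c\<in>insert x (X ` {..<N}). cball c r)" by blast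
  then show ?thesis by (rule hausdorff_mnc_le[OF \<open>0 < r\<close>, rotated]) simp
qed

lemma hausdorff_mnc_d_convergent_le_rho:
  fixes A :: "'a::real_banach_lattice complexification set"
  assumes "bounded A" "range X \<subseteq> A" "d_convergent X"
  shows "hausdorff_mnc (range X) \<le> rho A"
  unfolding rho_def
proof (rule cInf_greatest)
  \<comment> \<open>Boundedness yields some admissible radius, so the infimum is over a nonempty
    set.\<close>
  obtain \<delta> C where "0 < \<delta>" "finite C" "A \<subseteq> (\<Union>c\<in>C. cball c \<delta>)"
    using bounded_imp_finite_cball_cover[OF \<open>bounded A\<close>] by blast
  from this(1) finite_cover_imp_order_ball_cover[OF this]
  show "{\<delta>. 0 < \<delta> \<and> (\<exists>u. 0 \<le> u \<and>
      A \<subseteq> {x + \<delta> *\<^sub>R b | x b. x \<in> order_ball u \<and> b \<in> cball 0 1})} \<noteq> {}"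
    by (blast intro: sum_nonneg modulus_nonneg)
next
  fix \<delta>
  assume "\<delta> \<in> {\<delta>. 0 < \<delta> \<and> (\<exists>u. 0 \<le> u \<and>
      A \<subseteq> {x + \<delta> *\<^sub>R b | x b. x \<in> order_ball u \<and> b \<in> cball 0 1})}"
  then obtain u where \<delta>: "0 < \<delta>" and u: "0 \<le> u"
    "A \<subseteq> {x + \<delta> *\<^sub>R b | x b. x \<in> order_ball u \<and> b \<in> cball 0 1}" by blast
  obtain x where x: "d_converges X x sequentially"
    using \<open>d_convergent X\<close> unfolding d_convergent_def by blast
  show "hausdorff_mnc (range X) \<le> \<delta>"
  proof (rule field_le_epsilon)
    fix \<epsilon> :: real assume "0 < \<epsilon>"
    then show "hausdorff_mnc (range X) \<le> \<delta> + \<epsilon>"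
      using d_converges_norm_diff_le[OF x u(1) less_imp_le[OF \<delta>] _ order_trans[OF assms(2) u(2)]] \<delta>
      by (intro hausdorff_mnc_range_le[of _ _ x]) (simp_all add: dist_norm)
  qed
qed

theorem proposition28:
  fixes A :: "'a::real_banach_lattice complexification set"
  assumes "bounded A"
    and "\<exists>x :: nat \<Rightarrow> 'a complexification.
           range x \<subseteq> A \<and> d_convergent x \<and> hausdorff_mnc A = hausdorff_mnc (range x)"
  shows "hausdorff_mnc A = rho A"
  \<comment> \<open>The chain is \<rho>(A) \<le> \<chi>(A) = \<chi>(\<open>range x\<close>) \<le>
    \<rho>(A).\<close>
  using assms hausdorff_mnc_d_convergent_le_rho rho_le_hausdorff_mnc
  by (metis order.antisym)

end
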